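(* Let $\rho$ be a probability measure on $\mathbb{T}$ of the form $\rho=\sum_{k\ge 1}a_k\rho_k$, where $(\rho_k)_{k\ge1}$ is a sequence of probability measures on $\mathbb{T}$ such that $\rho_k$ is $2^{-k}$-invariant for each $k$, and $(a_k)_{k\ge 1}$ is a sequence of non-negative numbers with $\sum_{k\ge1} a_k=1$. Then, for every integer $n\ge 0$, $$e_{2^n}(\rho)^2\ \ge\ \sum_{k\ge n+1}a_k .$$
   Context: $\mathbb{T}$ is the unit circle. For a finite positive Borel measure $\rho$ on $\mathbb{T}$ and an integer $n\ge 0$, $e_n(\rho)\ge 0$ is defined by $$e_n(\rho)^2=\min_{q_0,\dots,q_{n-1}\in\mathbb{C}}\int_{\mathbb{T}}\bigl|t^n+q_{n-1}t^{n-1}+\dots+q_1t+q_0\bigr|^2\,d\rho(t).$$ A measure on $\mathbb{T}$ is called $\alpha$-invariant if it is invariant under the rotation by the angle $2\pi\alpha$, i.e. under $\theta\mapsto\theta+2\pi\alpha \bmod 2\pi$. *)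

theory Defs
  imports "HOL-Analysis.Analysis" "HOL-Probability.Probability_Measure"
begin

text \<open>Measures on the unit circle are measures \<open>\<rho>\<close> with
  \<open>sets \<rho> = sets circle_borel\<close>; this also forces \<open>space \<rho> = sphere 0 1\<close>.\<close>

definition circle_borel :: "complex measure" where
  "circle_borel = restrict_space borel (sphere 0 1)"

definition monic_norm_sq :: "nat \<Rightarrow> complex measure \<Rightarrow> (nat \<Rightarrow> complex) \<Rightarrow> real" where
  "monic_norm_sq n \<rho> q = (\<integral>t. (cmod (t ^ n + (\<Sum>j<n. q j * t ^ j)))\<^sup>2 \<partial>\<rho>)"

text \<open>Only \<open>q 0, \<dots>, q (n - 1)\<close> matter in \<open>monic_norm_sq n \<rho> q\<close>. For a finite measure on the
  circle the infimum is a minimum: see \<open>e_attained\<close> below.\<close>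

definition e_seq :: "nat \<Rightarrow> complex measure \<Rightarrow> real" where
  "e_seq n \<rho> = sqrt (INF q. monic_norm_sq n \<rho> q)"

definition rotation_invariant :: "real \<Rightarrow> complex measure \<Rightarrow> bool" where
  "rotation_invariant \<alpha> \<rho> \<longleftrightarrow> distr \<rho> \<rho> (\<lambda>t. cis (2 * pi * \<alpha>) * t) = \<rho>"


lemma space_circle:
  assumes "sets \<rho> = sets circle_borel"
  shows "space \<rho> = sphere 0 1"
  using sets_eq_imp_space_eq[OF assms] by (simp add: circle_borel_def space_restrict_space)

lemma measurable_rotation:
  assumes "sets \<rho> = sets circle_borel"
  shows "(\<lambda>t. cis x * t) \<in> measurable \<rho> \<rho>"
proof -
  have "(\<lambda>t. cis x * t) \<in> measurable circle_borel circle_borel"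
    unfolding circle_borel_def
    by (intro measurable_restrict_space3) (auto simp: norm_mult)
  then show ?thesis
    using measurable_cong_sets[OF assms assms] by simp
qed

lemma integrable_circle:
  fixes f :: "complex \<Rightarrow> 'b::{banach, second_countable_topology}"
  assumes "finite_measure \<rho>" "sets \<rho> = sets circle_borel" "continuous_on UNIV f"
  shows "integrable \<rho> f"
proof -
  interpret finite_measure \<rho> by fact
  have "bounded (f ` sphere 0 1)"
    by (intro compact_imp_bounded compact_continuous_image continuous_on_subset[OF assms(3)]) auto
  then obtain B where B: "\<And>x. x \<in> sphere 0 1 \<Longrightarrow> norm (f x) \<le> B"
    unfolding bounded_iff by blast
  have "f \<in> borel_measurable circle_borel"
    unfolding circle_borel_def
    by (intro measurable_restrict_space1 borel_measurable_continuous_onI assms(3))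
  then have "f \<in> borel_measurable \<rho>"
    using measurable_cong_sets[OF assms(2) refl] by blast
  then show ?thesis
    by (intro integrable_const_bound[of _ B]) (auto simp: space_circle[OF assms(2)] intro!: AE_I2 B)
qed

lemma monic_norm_sq_nonneg: "0 \<le> monic_norm_sq n \<rho> q"
  by (simp add: monic_norm_sq_def)

lemma e_nonneg: "0 \<le> e_seq n \<rho>"
  unfolding e_seq_def by (intro real_sqrt_ge_zero cINF_greatest) (auto simp: monic_norm_sq_nonneg)

lemma e_squared: "(e_seq n \<rho>)\<^sup>2 = (INF q. monic_norm_sq n \<rho> q)"
  unfolding e_seq_def by (intro real_sqrt_pow2 cINF_greatest) (auto simp: monic_norm_sq_nonneg)

lemma orthogonal_residual:
  assumes fin: "finite_measure \<rho>" and sets: "sets \<rho> = sets circle_borel"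
    and f: "continuous_on UNIV f"
  shows "\<exists>q. \<forall>i<N. (\<integral>t. (f t + (\<Sum>j<N. q j * t ^ j)) * cnj (t ^ i) \<partial>\<rho>) = 0"
  using f
proof (induction N arbitrary: f)
  case 0
  then show ?case by simp
next
  case (Suc N)
  note [continuous_intros] = Suc.prems
  obtain q where q: "\<And>i. i < N \<Longrightarrow> (\<integral>t. (f t + (\<Sum>j<N. q j * t ^ j)) * cnj (t ^ i) \<partial>\<rho>) = 0"
    using Suc.IH[OF Suc.prems] by blast
  obtain p where p: "\<And>i. i < N \<Longrightarrow> (\<integral>t. (t ^ N + (\<Sum>j<N. p j * t ^ j)) * cnj (t ^ i) \<partial>\<rho>) = 0"
    using Suc.IH[OF continuous_on_power[OF continuous_on_id, of UNIV N]] by blast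
  define r where "r = (\<lambda>t. f t + (\<Sum>j<N. q j * t ^ j))"
  define g where "g = (\<lambda>t. t ^ N + (\<Sum>j<N. p j * t ^ j))"
  have cr [continuous_intros]: "continuous_on UNIV r"
    unfolding r_def by (intro continuous_intros)
  have cg [continuous_intros]: "continuous_on UNIV g"
    unfolding g_def by (intro continuous_intros)
  have r0: "(\<integral>t. r t * cnj (t ^ i) \<partial>\<rho>) = 0" if "i < N" for i
    using q[OF that] by (simp add: r_def)
  have g0: "(\<integral>t. g t * cnj (t ^ i) \<partial>\<rho>) = 0" if "i < N" for i
    using p[OF that] by (simp add: g_def)
  define G where "G = (\<integral>t. g t * cnj (g t) \<partial>\<rho>)"
  define R where "R = (\<integral>t. r t * cnj (g t) \<partial>\<rho>)"
  define c where "c = - (if G = 0 then 0 else R / G)"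
  have RG: "R + c * G = 0"
  proof (cases "G = 0")
    case True
    have "G = (\<integral>t. complex_of_real ((cmod (g t))\<^sup>2) \<partial>\<rho>)"
      unfolding G_def by (simp only: complex_norm_square)
    also have "\<dots> = complex_of_real (\<integral>t. (cmod (g t))\<^sup>2 \<partial>\<rho>)"
      by (rule integral_complex_of_real)
    finally have "(\<integral>t. (cmod (g t))\<^sup>2 \<partial>\<rho>) = 0"
      using True by simp
    then have "AE t in \<rho>. (cmod (g t))\<^sup>2 = 0"
      by (subst (asm) integral_nonneg_eq_0_iff_AE) (auto intro!: integrable_circle[OF fin sets] continuous_intros)
    then have "AE t in \<rho>. r t * cnj (g t) = 0"
      by eventually_elim simp
    then have "R = 0"
      unfolding R_def by (rule integral_eq_zero_AE)
    then show ?thesis using True by simp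
  qed (simp add: c_def)
  define s where "s = (\<lambda>t. r t + c * g t)"
  have cs [continuous_intros]: "continuous_on UNIV s"
    unfolding s_def by (intro continuous_intros)
  have s_lin: "(\<integral>t. s t * cnj (h t) \<partial>\<rho>) = (\<integral>t. r t * cnj (h t) \<partial>\<rho>) + c * (\<integral>t. g t * cnj (h t) \<partial>\<rho>)"
    if [continuous_intros]: "continuous_on UNIV h" for h
  proof -
    have "(\<integral>t. s t * cnj (h t) \<partial>\<rho>) = (\<integral>t. r t * cnj (h t) + c * (g t * cnj (h t)) \<partial>\<rho>)"
      by (simp add: s_def algebra_simps)
    also have "\<dots> = (\<integral>t. r t * cnj (h t) \<partial>\<rho>) + (\<integral>t. c * (g t * cnj (h t)) \<partial>\<rho>)"
      by (rule Bochner_Integration.integral_add) (auto intro!: integrable_circle[OF fin sets] continuous_intros)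
    finally show ?thesis by simp
  qed
  have s0: "(\<integral>t. s t * cnj (t ^ i) \<partial>\<rho>) = 0" if "i < N" for i
    using s_lin[of "\<lambda>t. t ^ i"] r0[OF that] g0[OF that] by (simp add: continuous_intros)
  have sg: "(\<integral>t. s t * cnj (g t) \<partial>\<rho>) = 0"
    using s_lin[OF cg] RG by (simp add: R_def G_def)
  have sN: "(\<integral>t. s t * cnj (t ^ N) \<partial>\<rho>) = 0"
  proof -
    have "(\<integral>t. s t * cnj (g t) \<partial>\<rho>)
        = (\<integral>t. s t * cnj (t ^ N) + (\<Sum>j<N. cnj (p j) * (s t * cnj (t ^ j))) \<partial>\<rho>)"
      by (simp add: g_def algebra_simps sum_distrib_left)
    also have "\<dots> = (\<integral>t. s t * cnj (t ^ N) \<partial>\<rho>) + (\<integral>t. (\<Sum>j<N. cnj (p j) * (s t * cnj (t ^ j))) \<partial>\<rho>)"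
      by (rule Bochner_Integration.integral_add) (auto intro!: integrable_circle[OF fin sets] continuous_intros)
    also have "(\<integral>t. (\<Sum>j<N. cnj (p j) * (s t * cnj (t ^ j))) \<partial>\<rho>)
        = (\<Sum>j<N. (\<integral>t. cnj (p j) * (s t * cnj (t ^ j)) \<partial>\<rho>))"
      by (rule Bochner_Integration.integral_sum) (auto intro!: integrable_circle[OF fin sets] continuous_intros)
    also have "\<dots> = (\<Sum>j<N. cnj (p j) * (\<integral>t. s t * cnj (t ^ j) \<partial>\<rho>))"
      by simp
    also have "\<dots> = 0"
      using s0 by (intro sum.neutral) auto
    finally show ?thesis using sg by simp
  qed
  define u where "u = (\<lambda>j. if j < N then q j + c * p j else c)"
  have su: "f t + (\<Sum>j<Suc N. u j * t ^ j) = s t" for t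
    by (simp add: u_def s_def r_def g_def algebra_simps sum.distrib sum_distrib_left)
  show ?case
    by (rule exI[of _ u], unfold su) (use s0 sN in \<open>auto simp: less_Suc_eq\<close>)
qed

lemma e_attained:
  assumes fin: "finite_measure \<rho>" and sets: "sets \<rho> = sets circle_borel"
  shows "\<exists>q. (e_seq n \<rho>)\<^sup>2 = monic_norm_sq n \<rho> q \<and> (\<forall>q'. monic_norm_sq n \<rho> q \<le> monic_norm_sq n \<rho> q')"
proof -
  obtain q where q: "\<And>i. i < n \<Longrightarrow> (\<integral>t. (t ^ n + (\<Sum>j<n. q j * t ^ j)) * cnj (t ^ i) \<partial>\<rho>) = 0"
    using orthogonal_residual[OF fin sets continuous_on_power[OF continuous_on_id, of UNIV n], of n] by blast
  define r where "r = (\<lambda>t. t ^ n + (\<Sum>j<n. q j * t ^ j))"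
  have cr [continuous_intros]: "continuous_on UNIV r"
    unfolding r_def by (intro continuous_intros)
  have min: "monic_norm_sq n \<rho> q \<le> monic_norm_sq n \<rho> q'" for q'
  proof -
    define h where "h = (\<lambda>t. \<Sum>j<n. (q' j - q j) * t ^ j)"
    have ch [continuous_intros]: "continuous_on UNIV h"
      unfolding h_def by (intro continuous_intros)
    have rh: "t ^ n + (\<Sum>j<n. q' j * t ^ j) = r t + h t" for t
      by (simp add: r_def h_def algebra_simps sum_subtractf)
    have "(\<integral>t. r t * cnj (h t) \<partial>\<rho>) = (\<integral>t. (\<Sum>j<n. cnj (q' j - q j) * (r t * cnj (t ^ j))) \<partial>\<rho>)"
      by (simp add: h_def sum_distrib_left mult_ac)
    also have "\<dots> = (\<Sum>j<n. (\<integral>t. cnj (q' j - q j) * (r t * cnj (t ^ j)) \<partial>\<rho>))"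
      by (rule Bochner_Integration.integral_sum) (auto intro!: integrable_circle[OF fin sets] continuous_intros)
    also have "\<dots> = (\<Sum>j<n. cnj (q' j - q j) * (\<integral>t. r t * cnj (t ^ j) \<partial>\<rho>))"
      by simp
    also have "\<dots> = 0"
      using q by (intro sum.neutral) (auto simp: r_def)
    finally have "Re (\<integral>t. r t * cnj (h t) \<partial>\<rho>) = 0" by simp
    then have cross: "(\<integral>t. Re (r t * cnj (h t)) \<partial>\<rho>) = 0"
      by (subst integral_Re) (auto intro!: integrable_circle[OF fin sets] continuous_intros)
    have pt: "(cmod (r t + h t))\<^sup>2 = (cmod (r t))\<^sup>2 + 2 * Re (r t * cnj (h t)) + (cmod (h t))\<^sup>2" for t
      unfolding cmod_power2 by (simp add: power2_eq_square algebra_simps)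
    have "monic_norm_sq n \<rho> q = (\<integral>t. (cmod (r t))\<^sup>2 + 2 * Re (r t * cnj (h t)) \<partial>\<rho>)"
    proof -
      have "(\<integral>t. (cmod (r t))\<^sup>2 + 2 * Re (r t * cnj (h t)) \<partial>\<rho>)
          = (\<integral>t. (cmod (r t))\<^sup>2 \<partial>\<rho>) + (\<integral>t. 2 * Re (r t * cnj (h t)) \<partial>\<rho>)"
        by (rule Bochner_Integration.integral_add) (auto intro!: integrable_circle[OF fin sets] continuous_intros)
      also have "(\<integral>t. 2 * Re (r t * cnj (h t)) \<partial>\<rho>) = 2 * (\<integral>t. Re (r t * cnj (h t)) \<partial>\<rho>)"
        by (rule integral_mult_right_zero)
      finally show ?thesis
        by (simp only: cross monic_norm_sq_def) (simp add: r_def)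
    qed
    also have "\<dots> \<le> (\<integral>t. (cmod (r t + h t))\<^sup>2 \<partial>\<rho>)"
      by (rule integral_mono) (auto simp: pt intro!: integrable_circle[OF fin sets] continuous_intros)
    also have "\<dots> = monic_norm_sq n \<rho> q'"
      by (simp add: monic_norm_sq_def rh)
    finally show ?thesis .
  qed
  have "(INF q. monic_norm_sq n \<rho> q) = monic_norm_sq n \<rho> q"
    by (rule cInf_eq_minimum) (auto simp: min)
  then show ?thesis
    using min by (auto simp: e_squared)
qed

end

theory Submission
  imports Defs
begin

text \<open>
  If \<open>m < 2 ^ k\<close>, then \<open>2\<^sup>-\<^sup>k\<close>-invariance makes \<open>t ^ m\<close> orthogonal to \<open>1, t, \<dots>, t ^ (m - 1)\<close> in
  \<open>L\<^sup>2(\<rho>\<^sub>k)\<close>, so by Pythagoras every monic polynomial of degree \<open>m\<close> has norm at least \<open>1\<close> there.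
  For \<open>m = 2 ^ n\<close> this applies to all \<open>k > n\<close>, and \<open>\<rho> \<ge> \<Sum>k\<in>F. a\<^sub>k \<rho>\<^sub>k\<close> for every finite \<open>F\<close>.
\<close>

lemma cis_neq_1:
  assumes "0 < x" "x < 2 * pi"
  shows "cis x \<noteq> 1"
proof
  assume "cis x = 1"
  then have "cos x = 1"
    by (metis cis.simps(1) one_complex.simps(1))
  then obtain i :: int where i: "x = of_int i * 2 * pi"
    by (auto simp: cos_one_2pi_int)
  with assms have "0 < (of_int i :: real)" "(of_int i :: real) < 1"
    by (auto simp: zero_less_mult_iff)
  then have "0 < i" "i < 1"
    by (simp_all only: of_int_0_less_iff of_int_less_1_iff)
  then show False by simp
qed

lemma rotation_invariant_integral:
  fixes g :: "complex \<Rightarrow> 'b::{banach, second_countable_topology}"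
  assumes sets: "sets \<rho> = sets circle_borel"
    and inv: "rotation_invariant \<alpha> \<rho>"
    and g: "g \<in> borel_measurable \<rho>"
  shows "(\<integral>t. g (cis (2 * pi * \<alpha>) * t) \<partial>\<rho>) = (\<integral>t. g t \<partial>\<rho>)"
proof -
  have "(\<integral>t. g t \<partial>\<rho>) = (\<integral>t. g t \<partial>(distr \<rho> \<rho> (\<lambda>t. cis (2 * pi * \<alpha>) * t)))"
    using inv by (simp add: rotation_invariant_def)
  also have "\<dots> = (\<integral>t. g (cis (2 * pi * \<alpha>) * t) \<partial>\<rho>)"
    by (rule integral_distr[OF measurable_rotation[OF sets] g])
  finally show ?thesis by simp
qed

text \<open>With \<open>w\<close> the root of unity of angle 2 pi / \<open>N\<close>, replacing t by
  \<open>w * t\<close> leaves the integral unchanged by invariance, yet multiplies it by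
  \<open>w ^ (m - j)\<close>. Since 0 < \<open>m - j\<close> < \<open>N\<close>, this factor differs
  from 1, so the integral must vanish.\<close>

lemma rotation_invariant_orthogonal:
  assumes fin: "finite_measure \<rho>" and sets: "sets \<rho> = sets circle_borel"
    and inv: "rotation_invariant (1 / real N) \<rho>" and jm: "j < m" and mN: "m < N"
  shows "(\<integral>t. t ^ m * cnj (t ^ j) \<partial>\<rho>) = 0"
proof -
  define w where "w = cis (2 * pi * (1 / real N))"
  define I where "I = (\<integral>t. t ^ m * cnj (t ^ j) \<partial>\<rho>)"
  have "integrable \<rho> (\<lambda>t. t ^ m * cnj (t ^ j))"
    by (intro integrable_circle[OF fin sets] continuous_intros)
  then have "(\<integral>t. (w * t) ^ m * cnj ((w * t) ^ j) \<partial>\<rho>) = I"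
    unfolding w_def I_def
    by (intro rotation_invariant_integral[OF sets inv] borel_measurable_integrable)
  moreover have "(w * t) ^ m * cnj ((w * t) ^ j) = w ^ m * cnj (w ^ j) * (t ^ m * cnj (t ^ j))" for t
    by (simp add: power_mult_distrib mult_ac)
  moreover have "w ^ m * cnj (w ^ j) = w ^ (m - j)"
  proof -
    have "w ^ m = w ^ (m - j) * w ^ j"
      using jm by (simp flip: power_add)
    \<comment> \<open>\<open>w\<close> lies on the unit circle, so conjugating a power inverts
      it.\<close>
    moreover have "w ^ j * cnj (w ^ j) = 1"
      by (simp only: complex_norm_square[symmetric]) (simp add: w_def norm_power)
    ultimately show ?thesis by simp
  qed
  ultimately have "w ^ (m - j) * I = I"
    by (simp add: I_def)
  moreover have "w ^ (m - j) \<noteq> 1"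
  proof -
    have "real (m - j) / real N < 1"
      using mN by simp
    then have "2 * pi * (real (m - j) / real N) < 2 * pi * 1"
      by (rule mult_strict_left_mono) simp
    \<comment> \<open>By de Moivre the power has angle 2 pi (\<open>m - j\<close>) /
      \<open>N\<close>, strictly between 0 and a full turn.\<close>
    then show ?thesis
      unfolding w_def Complex.DeMoivre using jm mN
      by (intro cis_neq_1) (simp_all add: mult_ac)
  qed
  ultimately show ?thesis
    by (simp add: I_def)
qed

lemma monic_norm_sq_ge_1:
  assumes prob: "prob_space \<rho>" and sets: "sets \<rho> = sets circle_borel"
    and inv: "rotation_invariant (1 / real N) \<rho>" and mN: "m < N"
  shows "1 \<le> monic_norm_sq m \<rho> q"
proof -
  interpret prob_space \<rho> by fact
  note int = integrable_circle[OF finite_measure_axioms sets]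
  define h where "h = (\<lambda>t. \<Sum>j<m. q j * t ^ j)"
  have ch [continuous_intros]: "continuous_on UNIV h"
    unfolding h_def by (intro continuous_intros)
  have "(\<integral>t. t ^ m * cnj (h t) \<partial>\<rho>) = (\<integral>t. (\<Sum>j<m. cnj (q j) * (t ^ m * cnj (t ^ j))) \<partial>\<rho>)"
    by (simp add: h_def sum_distrib_left mult_ac)
  also have "\<dots> = (\<Sum>j<m. (\<integral>t. cnj (q j) * (t ^ m * cnj (t ^ j)) \<partial>\<rho>))"
    by (rule Bochner_Integration.integral_sum) (auto intro!: int continuous_intros)
  also have "\<dots> = (\<Sum>j<m. cnj (q j) * (\<integral>t. t ^ m * cnj (t ^ j) \<partial>\<rho>))"
    by (simp only: integral_mult_right_zero)
  also have "\<dots> = 0"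
    using rotation_invariant_orthogonal[OF finite_measure_axioms sets inv _ mN]
    by (intro sum.neutral) auto
  finally have "Re (\<integral>t. t ^ m * cnj (h t) \<partial>\<rho>) = 0" by simp
  then have cross: "(\<integral>t. Re (t ^ m * cnj (h t)) \<partial>\<rho>) = 0"
    by (subst integral_Re) (auto intro!: int continuous_intros)
  \<comment> \<open>The constant 1 is rewritten as an integral, using total mass 1 and the vanishing
    cross term, so that only a pointwise comparison remains: on the circle \<open>t ^ m\<close> has
    modulus 1, and expanding the square and dropping the term with \<open>h t\<close> squared gives
    the bound.\<close>
  have "1 = (\<integral>t. 1 + 2 * Re (t ^ m * cnj (h t)) \<partial>\<rho>)"
  proof -
    have "(\<integral>t. 1 + 2 * Re (t ^ m * cnj (h t)) \<partial>\<rho>)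
        = (\<integral>t. 1 \<partial>\<rho>) + (\<integral>t. 2 * Re (t ^ m * cnj (h t)) \<partial>\<rho>)"
      by (rule Bochner_Integration.integral_add) (auto intro!: int continuous_intros)
    also have "(\<integral>t. 2 * Re (t ^ m * cnj (h t)) \<partial>\<rho>) = 2 * (\<integral>t. Re (t ^ m * cnj (h t)) \<partial>\<rho>)"
      by (rule integral_mult_right_zero)
    finally show ?thesis
      by (simp only: cross) (simp add: prob_space)
  qed
  also have "\<dots> \<le> (\<integral>t. (cmod (t ^ m + h t))\<^sup>2 \<partial>\<rho>)"
  proof (rule integral_mono)
    fix t assume "t \<in> space \<rho>"
    then have "(cmod (t ^ m))\<^sup>2 = 1"
      by (simp add: space_circle[OF sets] norm_power)
    moreover have "(cmod (z + w))\<^sup>2 = (cmod z)\<^sup>2 + 2 * Re (z * cnj w) + (cmod w)\<^sup>2" for z w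
      unfolding cmod_power2 by (simp add: power2_eq_square algebra_simps)
    ultimately show "1 + 2 * Re (t ^ m * cnj (h t)) \<le> (cmod (t ^ m + h t))\<^sup>2"
      by simp
  qed (auto intro!: int continuous_intros)
  finally show ?thesis
    by (simp add: monic_norm_sq_def h_def)
qed

text \<open>Carries domination of measures from sets to integrals without forming the weighted sum
  of the \<open>N i\<close> as a measure. The induction follows the construction of the integral:
  indicators are the hypothesis \<open>le\<close>, and scaling, addition and monotone limits
  preserve the inequality.\<close>

lemma sum_nn_integral_le:
  fixes c :: "'i \<Rightarrow> ennreal"
  assumes f: "f \<in> borel_measurable M"
    and sets: "\<And>i. i \<in> F \<Longrightarrow> sets (N i) = sets M"
    and le: "\<And>A. A \<in> sets M \<Longrightarrow> (\<Sum>i\<in>F. c i * emeasure (N i) A) \<le> emeasure M A"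
  shows "(\<Sum>i\<in>F. c i * (\<integral>\<^sup>+x. f x \<partial>N i)) \<le> (\<integral>\<^sup>+x. f x \<partial>M)"
  using f
proof (induction rule: borel_measurable_induct)
  case (cong f g)
  have "(\<integral>\<^sup>+x. f x \<partial>N i) = (\<integral>\<^sup>+x. g x \<partial>N i)" if "i \<in> F" for i
    using cong(3) sets_eq_imp_space_eq[OF sets[OF that]] by (intro nn_integral_cong) auto
  moreover have "(\<integral>\<^sup>+x. f x \<partial>M) = (\<integral>\<^sup>+x. g x \<partial>M)"
    using cong(3) by (intro nn_integral_cong) auto
  ultimately show ?case using cong(4) by simp
next
  case (set A)
  then show ?case using le[of A] sets by simp
next
  case (mult u b)
  \<comment> \<open>The induction supplies measurability for \<open>M\<close> only; equality of the
    sigma-algebras carries it to each \<open>N i\<close>.\<close>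
  have "u \<in> borel_measurable (N i)" if "i \<in> F" for i
    using mult(2) measurable_cong_sets[OF sets[OF that] refl] by blast
  then have "(\<Sum>i\<in>F. c i * (\<integral>\<^sup>+x. b * u x \<partial>N i)) = b * (\<Sum>i\<in>F. c i * (\<integral>\<^sup>+x. u x \<partial>N i))"
    by (simp add: nn_integral_cmult sum_distrib_left mult.left_commute)
  then show ?case
    using mult by (simp add: nn_integral_cmult mult_left_mono)
next
  case (add u v)
  have "u \<in> borel_measurable (N i)" "v \<in> borel_measurable (N i)" if "i \<in> F" for i
    using add(1,3) measurable_cong_sets[OF sets[OF that] refl] by blast+
  then have "(\<Sum>i\<in>F. c i * (\<integral>\<^sup>+x. v x + u x \<partial>N i))
      = (\<Sum>i\<in>F. c i * (\<integral>\<^sup>+x. v x \<partial>N i)) + (\<Sum>i\<in>F. c i * (\<integral>\<^sup>+x. u x \<partial>N i))"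
    by (simp add: nn_integral_add distrib_left sum.distrib)
  then show ?case
    using add by (simp add: nn_integral_add add_mono)
next
  case (seq U)
  have "U j \<in> borel_measurable (N i)" if "i \<in> F" for i j
    using seq(1) measurable_cong_sets[OF sets[OF that] refl] by blast
  then have "(\<Sum>i\<in>F. c i * (\<integral>\<^sup>+x. (SUP j. U j x) \<partial>N i))
      = (\<Sum>i\<in>F. SUP j. c i * (\<integral>\<^sup>+x. U j x \<partial>N i))"
    using seq(3) by (simp add: nn_integral_monotone_convergence_SUP SUP_mult_left_ennreal)
  \<comment> \<open>Each summand increases with \<open>j\<close>, which is what allows the supremum
    to be pulled out of the sum.\<close>
  also have "\<dots> = (SUP j. \<Sum>i\<in>F. c i * (\<integral>\<^sup>+x. U j x \<partial>N i))"
    by (rule ennreal_SUP_sum[symmetric])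
      (auto intro!: incseq_SucI mult_left_mono nn_integral_mono le_funD[OF incseq_SucD[OF seq(3)]])
  also have "\<dots> \<le> (SUP j. \<integral>\<^sup>+x. U j x \<partial>M)"
    by (intro SUP_mono') (rule seq.IH)
  also have "\<dots> = (\<integral>\<^sup>+x. (SUP j. U j x) \<partial>M)"
    using seq(1,3) by (simp add: nn_integral_monotone_convergence_SUP)
  finally show ?case by (simp add: image_comp)
qed

text \<open>Real-valued form of \<open>sum_nn_integral_le\<close>. Finiteness of the measures
  identifies \<open>measure\<close> with \<open>emeasure\<close>, and integrability with
  nonnegativity identifies the two kinds of integral.\<close>

lemma sum_integral_le:
  fixes c :: "'i \<Rightarrow> real" and f :: "'a \<Rightarrow> real"
  assumes f: "integrable M f" "\<And>i. i \<in> F \<Longrightarrow> integrable (N i) f" "\<And>x. 0 \<le> f x"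
    and fin: "finite_measure M" "\<And>i. i \<in> F \<Longrightarrow> finite_measure (N i)"
    and sets: "\<And>i. i \<in> F \<Longrightarrow> sets (N i) = sets M"
    and c: "\<And>i. i \<in> F \<Longrightarrow> 0 \<le> c i"
    and le: "\<And>A. A \<in> sets M \<Longrightarrow> (\<Sum>i\<in>F. c i * measure (N i) A) \<le> measure M A"
  shows "(\<Sum>i\<in>F. c i * (\<integral>x. f x \<partial>N i)) \<le> (\<integral>x. f x \<partial>M)"
proof -
  have "(\<Sum>i\<in>F. ennreal (c i) * emeasure (N i) A) \<le> emeasure M A" if "A \<in> sets M" for A
  proof -
    have "(\<Sum>i\<in>F. ennreal (c i) * emeasure (N i) A) = (\<Sum>i\<in>F. ennreal (c i * measure (N i) A))"
      by (intro sum.cong refl) (simp add: c ennreal_mult finite_measure.emeasure_eq_measure[OF fin(2)])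
    also have "\<dots> = ennreal (\<Sum>i\<in>F. c i * measure (N i) A)"
      by (intro sum_ennreal) (simp add: c)
    also have "\<dots> \<le> ennreal (measure M A)"
      by (intro ennreal_leI le that)
    finally show ?thesis
      by (simp add: finite_measure.emeasure_eq_measure[OF fin(1)])
  qed
  then have "(\<Sum>i\<in>F. ennreal (c i) * (\<integral>\<^sup>+x. ennreal (f x) \<partial>N i)) \<le> (\<integral>\<^sup>+x. ennreal (f x) \<partial>M)"
    using f(1) by (intro sum_nn_integral_le sets) auto
  also have "(\<integral>\<^sup>+x. ennreal (f x) \<partial>M) = ennreal (\<integral>x. f x \<partial>M)"
    using f by (intro nn_integral_eq_integral) auto
  also have "(\<Sum>i\<in>F. ennreal (c i) * (\<integral>\<^sup>+x. ennreal (f x) \<partial>N i)) = (\<Sum>i\<in>F. ennreal (c i * (\<integral>x. f x \<partial>N i)))"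
    using f c by (intro sum.cong refl) (simp add: nn_integral_eq_integral ennreal_mult)
  also have "\<dots> = ennreal (\<Sum>i\<in>F. c i * (\<integral>x. f x \<partial>N i))"
    using f(3) c by (intro sum_ennreal) simp
  finally show ?thesis
    using f(3) by (subst (asm) ennreal_le_iff) auto
qed

theorem lemma2:
  fixes \<rho> :: "complex measure"
    and \<rho>s :: "nat \<Rightarrow> complex measure"
    and a :: "nat \<Rightarrow> real"
    and n :: nat
  assumes "prob_space \<rho>" and "sets \<rho> = sets circle_borel"
    and "\<And>k. k \<ge> 1 \<Longrightarrow> prob_space (\<rho>s k)"
    and "\<And>k. k \<ge> 1 \<Longrightarrow> sets (\<rho>s k) = sets circle_borel"
    and "\<And>k. k \<ge> 1 \<Longrightarrow> rotation_invariant (1 / 2 ^ k) (\<rho>s k)"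
    and "\<And>k. k \<ge> 1 \<Longrightarrow> a k \<ge> 0"
    and "(a has_sum 1) {1..}"
    and "\<And>A. A \<in> sets circle_borel \<Longrightarrow>
           ((\<lambda>k. a k * measure (\<rho>s k) A) has_sum measure \<rho> A) {1..}"
  shows "(e_seq (2 ^ n) \<rho>)\<^sup>2 \<ge> (\<Sum>\<^sub>\<infinity>k\<in>{n + 1..}. a k)"
proof -
  have fin: "finite_measure \<rho>"
    using assms(1) by (rule prob_space.finite_measure)
  have fins: "finite_measure (\<rho>s k)" if "k \<ge> 1" for k
    using assms(3)[OF that] by (rule prob_space.finite_measure)
  have "(\<Sum>\<^sub>\<infinity>k\<in>{n + 1..}. a k) \<le> monic_norm_sq (2 ^ n) \<rho> q" for q
  \<comment> \<open>Bounding every finite partial sum of the tail suffices, so no countable sum of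
    integrals has to be handled.\<close>
  proof (rule infsum_le_finite_sums)
    show "a summable_on {n + 1..}"
      by (rule summable_on_subset_banach[OF has_sum_imp_summable[OF assms(7)]]) auto
  next
    fix F assume F: "finite F" "F \<subseteq> {n + 1..}"
    then have ge1: "k \<ge> 1" if "k \<in> F" for k
      using that by auto
    define f where "f = (\<lambda>t. (cmod (t ^ (2 ^ n) + (\<Sum>j<2 ^ n. q j * t ^ j)))\<^sup>2)"
    have cf: "continuous_on UNIV f"
      unfolding f_def by (intro continuous_intros)
    have "(\<Sum>k\<in>F. a k) \<le> (\<Sum>k\<in>F. a k * (\<integral>t. f t \<partial>\<rho>s k))"
    proof (rule sum_mono)
      fix k assume k: "k \<in> F"
      \<comment> \<open>The tail starts at \<open>n + 1\<close> because the orthogonality argument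
        needs the degree strictly below the order of the rotation; at k = \<open>n\<close> the
        exponent j = 0 would give the factor 1.\<close>
      have "(2::nat) ^ n < 2 ^ k"
        using F k by (intro power_strict_increasing) auto
      then have "1 \<le> monic_norm_sq (2 ^ n) (\<rho>s k) q"
        using assms(3,4,5)[OF ge1[OF k]] by (intro monic_norm_sq_ge_1[of _ "2 ^ k"]) simp_all
      then show "a k \<le> a k * (\<integral>t. f t \<partial>\<rho>s k)"
        using mult_left_mono[OF _ assms(6)[OF ge1[OF k]], of 1]
        by (simp add: monic_norm_sq_def f_def)
    qed
    also have "\<dots> \<le> (\<integral>t. f t \<partial>\<rho>)"
    proof (rule sum_integral_le)
      fix A assume "A \<in> sets \<rho>"
      then have "((\<lambda>k. a k * measure (\<rho>s k) A) has_sum measure \<rho> A) {1..}"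
        using assms(2,8) by simp
      \<comment> \<open>The indices outside \<open>F\<close> contribute nonnegative terms to the
        series for \<open>measure \<rho> A\<close>.\<close>
      then show "(\<Sum>k\<in>F. a k * measure (\<rho>s k) A) \<le> measure \<rho> A"
        by (rule has_sum_mono2[OF has_sum_finite[OF F(1)]])
          (auto simp: assms(6) dest: ge1)
    qed (use assms ge1 fin fins cf in \<open>auto intro!: integrable_circle simp: f_def\<close>)
    finally show "sum a F \<le> monic_norm_sq (2 ^ n) \<rho> q"
      by (simp add: monic_norm_sq_def f_def)
  qed
  \<comment> \<open>The bound is uniform in \<open>q\<close>, so it passes to the infimum that
    equals the square of \<open>e_seq\<close>.\<close>
  then show ?thesis
    unfolding e_squared by (intro cINF_greatest) auto
qed

end
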